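(* Let $G$ be a non-locally cyclic group of order $n$ with $|Cyc(G)|=1$. Then $\overline{\Gamma}_G\cong K_3\cup (n-4)K_1$ if and only if $n=8$ and $G\cong D_8$.
   Context: A group is locally cyclic if every finitely generated subgroup is cyclic (so a finite group is non-locally cyclic iff it is not cyclic). For a group $G$, the cyclicizer is $Cyc(G)=\{y\in G \mid \langle x,y\rangle \text{ is cyclic for all } x\in G\}$. For a non-locally cyclic finite group $G$, the non-cyclic graph $\Gamma_G$ is the simple graph with vertex set $G\setminus Cyc(G)$ in which two distinct vertices $x,y$ are adjacent if and only if $\langle x,y\rangle$ is not cyclic; $\overline{\Gamma}_G$ is its complement (same vertex set, distinct $x,y$ adjacent iff $\langle x,y\rangle$ is cyclic). $K_m$ is the complete graph on $m$ vertices, $mK_1$ is the graph of $m$ isolated vertices (meaningful only for $m\ge 0$), and $\cup$ is disjoint union of graphs. $D_{2m}$ denotes the dihedral group of order $2m$. *)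

theory Defs
  imports "HOL-Algebra.Elementary_Groups" "Graph_Theory.Pair_Digraph"
    "Graph_Theory.Digraph_Isomorphism"
begin

section \<open>Cyclicizer and non-cyclic graph of a group\<close>

definition locally_cyclic :: "('a, 'b) monoid_scheme \<Rightarrow> bool" where
  "locally_cyclic G \<longleftrightarrow>
     (\<forall>S. finite S \<and> S \<subseteq> carrier G \<longrightarrow> cyclic_group (subgroup_generated G S))"

definition cyclicizer :: "('a, 'b) monoid_scheme \<Rightarrow> 'a set" where
  "cyclicizer G =
     {y \<in> carrier G. \<forall>x \<in> carrier G. cyclic_group (subgroup_generated G {x, y})}"

text \<open>
  A simple graph is represented by a loop-free symmetric relation on its vertex set.
\<close>

definition non_cyclic_graph :: "('a, 'b) monoid_scheme \<Rightarrow> 'a pair_pre_digraph" where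
  "non_cyclic_graph G =
     \<lparr>pverts = carrier G - cyclicizer G,
      parcs = {(x, y). x \<in> carrier G - cyclicizer G \<and> y \<in> carrier G - cyclicizer G \<and> x \<noteq> y \<and>
                       \<not> cyclic_group (subgroup_generated G {x, y})}\<rparr>"

section \<open>Graph constructions\<close>

definition graph_complement :: "'a pair_pre_digraph \<Rightarrow> 'a pair_pre_digraph" where
  "graph_complement X =
     \<lparr>pverts = pverts X,
      parcs = {(u, v). u \<in> pverts X \<and> v \<in> pverts X \<and> u \<noteq> v \<and> (u, v) \<notin> parcs X}\<rparr>"

definition complete_graph :: "nat \<Rightarrow> nat pair_pre_digraph" where
  "complete_graph m =
     \<lparr>pverts = {..<m}, parcs = {(i, j). i < m \<and> j < m \<and> i \<noteq> j}\<rparr>"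

definition isolated_vertices :: "nat \<Rightarrow> nat pair_pre_digraph" where
  "isolated_vertices m = \<lparr>pverts = {..<m}, parcs = {}\<rparr>"

definition disjoint_union ::
    "'a pair_pre_digraph \<Rightarrow> 'b pair_pre_digraph \<Rightarrow> ('a + 'b) pair_pre_digraph" where
  "disjoint_union X Y =
     \<lparr>pverts = pverts X <+> pverts Y,
      parcs = map_prod Inl Inl ` parcs X \<union> map_prod Inr Inr ` parcs Y\<rparr>"

definition graph_iso :: "'a pair_pre_digraph \<Rightarrow> 'b pair_pre_digraph \<Rightarrow> bool" where
  "graph_iso X Y \<longleftrightarrow> digraph_iso (with_proj X) (with_proj Y)"

lemma pair_graph_non_cyclic_graph:
  assumes "finite (carrier G)"
  shows "pair_graph (non_cyclic_graph G)"
proof -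
  have "parcs (non_cyclic_graph G) \<subseteq> carrier G \<times> carrier G"
    by (auto simp: non_cyclic_graph_def)
  then have "finite (parcs (non_cyclic_graph G))"
    using assms finite_subset by blast
  then show ?thesis
    using assms
    by unfold_locales
      (auto simp: non_cyclic_graph_def symmetric_def insert_commute intro!: symI)
qed

lemma pair_graph_graph_complement:
  assumes "pair_graph X"
  shows "pair_graph (graph_complement X)"
proof -
  interpret pair_graph X by fact
  have "parcs (graph_complement X) \<subseteq> pverts X \<times> pverts X"
    by (auto simp: graph_complement_def)
  then have "finite (parcs (graph_complement X))"
    using pair_finite_verts finite_subset by blast
  then show ?thesis
    using pair_finite_verts arcs_symmetric
    by unfold_locales (auto simp: graph_complement_def symmetric_def intro!: symI)
qed

section \<open>Dihedral groups\<close>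

text \<open>
  The group of order \<open>2 * m\<close> presented by
  \<open>r^m = s^2 = 1\<close> and \<open>s r s = r^(-1)\<close>; the pair \<open>(a, e)\<close> stands for
  \<open>r^a s^e\<close>.  For \<open>m = 0\<close> this is the infinite dihedral group.
\<close>

definition dihedral_group :: "nat \<Rightarrow> (int \<times> bool) monoid" where
  "dihedral_group m =
     \<lparr>carrier = carrier (integer_mod_group m) \<times> UNIV,
      monoid.mult = (\<lambda>(a, e) (b, f). ((if e then a - b else a + b) mod int m, e \<noteq> f)),
      one = (0, False)\<rparr>"

lemma order_dihedral_group: "m > 0 \<Longrightarrow> order (dihedral_group m) = 2 * m"
  by (simp add: order_def dihedral_group_def carrier_integer_mod_group card_cartesian_product)

lemma group_dihedral_group: "group (dihedral_group m)"
proof (rule groupI)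
  fix x y assume "x \<in> carrier (dihedral_group m)" "y \<in> carrier (dihedral_group m)"
  then show "x \<otimes>\<^bsub>dihedral_group m\<^esub> y \<in> carrier (dihedral_group m)"
    by (auto simp: dihedral_group_def carrier_integer_mod_group)
next
  show "\<one>\<^bsub>dihedral_group m\<^esub> \<in> carrier (dihedral_group m)"
    by (auto simp: dihedral_group_def carrier_integer_mod_group)
next
  fix x y z
  show "x \<otimes>\<^bsub>dihedral_group m\<^esub> y \<otimes>\<^bsub>dihedral_group m\<^esub> z =
        x \<otimes>\<^bsub>dihedral_group m\<^esub> (y \<otimes>\<^bsub>dihedral_group m\<^esub> z)"
    by (auto simp: dihedral_group_def mod_simps algebra_simps split: prod.splits)
next
  fix x assume "x \<in> carrier (dihedral_group m)"
  then show "\<one>\<^bsub>dihedral_group m\<^esub> \<otimes>\<^bsub>dihedral_group m\<^esub> x = x"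
    by (auto simp: dihedral_group_def carrier_integer_mod_group split: if_splits)
next
  fix x assume x: "x \<in> carrier (dihedral_group m)"
  obtain a e where [simp]: "x = (a, e)" by (cases x)
  show "\<exists>y \<in> carrier (dihedral_group m). y \<otimes>\<^bsub>dihedral_group m\<^esub> x = \<one>\<^bsub>dihedral_group m\<^esub>"
    using x
    by (intro bexI[of _ "(if e then a else - a mod int m, e)"])
      (auto simp: dihedral_group_def carrier_integer_mod_group mod_simps split: if_splits)
qed

end

theory Submission
  imports Defs "HOL-Algebra.Multiplicative_Group"
begin

text \<open>
  Write \<open>\<langle>x\<rangle>\<close> for \<open>generate G {x}\<close>.  Both sides of the equivalence say the same thing about
  \<open>G\<close>: there is an element \<open>x\<close> of order 4 such that every element outside \<open>\<langle>x\<rangle>\<close> squares to the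
  identity.

  On the graph side (\<open>triangle_plus_isolated_iff\<close>), the vertices are the nontrivial elements,
  since the cyclicizer always contains the identity, and two of them are adjacent if and only if
  they are powers of a common element (\<open>cyclic_group_pair_iff\<close>).  Hence the nontrivial elements of
  a cyclic subgroup form a clique, and an element \<open>z\<close> with \<open>z \<otimes> z \<noteq> \<one>\<close> is adjacent to its inverse.
  If the edges form a single triangle \<open>T\<close>, all such \<open>z\<close> therefore lie in \<open>T\<close>, together with the
  nontrivial part of \<open>\<langle>z\<rangle>\<close>; combining edges of \<open>T\<close> yields one \<open>x\<close> with
  \<open>\<langle>x\<rangle> = insert \<one> T\<close> (\<open>cyclic_subgroup_of_unique_triangle\<close>).  Conversely, an element outside \<open>\<langle>x\<rangle>\<close>
  that squares to the identity generates too little to create an edge, so the only edges are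
  those within \<open>\<langle>x\<rangle>\<close> (\<open>cyclic_pair_iff_if_involutions_outside\<close>).

  On the group side (\<open>iso_dihedral_group_4_iff\<close>), the condition characterises dihedral groups
  among the groups different from \<open>\<langle>x\<rangle>\<close>, and this holds for every rotation order other than 1
  and 2 (\<open>iso_dihedral_groupI\<close>, \<open>iso_dihedral_groupD\<close>): if \<open>y \<notin> \<langle>x\<rangle>\<close>, then \<open>y\<close> and \<open>y \<otimes> x\<close> are both
  involutions, which is exactly the dihedral relation, and two elements outside \<open>\<langle>x\<rangle>\<close> have a
  product that centralises \<open>x\<close> and so lies in \<open>\<langle>x\<rangle>\<close>.  The case \<open>\<langle>x\<rangle> = G\<close> is excluded because
  \<open>x\<close> would then lie in the cyclicizer.
\<close>

section \<open>Graph isomorphism\<close>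

text \<open>
  An arc is the pair of its ends, so the arc component of an isomorphism is determined by
  its vertex component.
\<close>

lemma graph_iso_iff:
  "graph_iso X Y \<longleftrightarrow> parcs X \<subseteq> pverts X \<times> pverts X \<and>
     (\<exists>f. inj_on f (pverts X) \<and> pverts Y = f ` pverts X \<and> parcs Y = map_prod f f ` parcs X)"
  (is "_ \<longleftrightarrow> ?R")
proof
  assume "graph_iso X Y"
  then obtain h where h: "pre_digraph.digraph_isomorphism (with_proj X) h"
      and Y: "with_proj Y = app_iso h (with_proj X)"
    unfolding graph_iso_def digraph_iso_def by blast
  have arc: "iso_verts h (fst e) = iso_tail h (iso_arcs h e)"
             "iso_verts h (snd e) = iso_head h (iso_arcs h e)" if "e \<in> parcs X" for e
    using h that by (simp_all add: pre_digraph.digraph_isomorphism_def)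
  have wf: "wf_digraph (with_proj X)" and inj: "inj_on (iso_verts h) (pverts X)"
    using h by (simp_all add: pre_digraph.digraph_isomorphism_def)
  have tails: "iso_tail h = fst" "iso_head h = snd"
    and Y': "pverts Y = iso_verts h ` pverts X" "parcs Y = iso_arcs h ` parcs X"
    using Y by (simp_all add: with_proj_def app_iso_def)
  have "iso_arcs h e = map_prod (iso_verts h) (iso_verts h) e" if "e \<in> parcs X" for e
    using arc[OF that] by (cases e; cases "iso_arcs h e") (simp add: tails)
  then have "parcs Y = map_prod (iso_verts h) (iso_verts h) ` parcs X"
    using Y' by auto
  moreover have "parcs X \<subseteq> pverts X \<times> pverts X"
    using wf by (auto simp: wf_digraph_def)
  ultimately show ?R using inj Y' by blast
next
  assume ?R
  then obtain f where sub: "parcs X \<subseteq> pverts X \<times> pverts X" and f: "inj_on f (pverts X)"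
      "pverts Y = f ` pverts X" "parcs Y = map_prod f f ` parcs X" by blast
  define h where "h = \<lparr>iso_verts = f, iso_arcs = map_prod f f, iso_head = snd, iso_tail = fst\<rparr>"
  have "inj_on (map_prod f f) (parcs X)"
    using map_prod_inj_on[OF f(1) f(1)] sub by (rule inj_on_subset)
  then have "pre_digraph.digraph_isomorphism (with_proj X) h"
    using sub f by (auto simp: h_def pre_digraph.digraph_isomorphism_def wf_digraph_def)
  moreover have "with_proj Y = app_iso h (with_proj X)"
    using f by (simp add: h_def with_proj_def app_iso_def)
  ultimately show "graph_iso X Y"
    unfolding graph_iso_def digraph_iso_def by blast
qed

text \<open>
  This removes the concrete vertex type \<open>nat + nat\<close>: what remains of an isomorphism is the set
  \<open>T\<close> of vertices sent to the complete part, because any bijections of the two parts will do.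
\<close>

lemma graph_iso_complete_plus_isolated_iff:
  "graph_iso X (disjoint_union (complete_graph k) (isolated_vertices m)) \<longleftrightarrow>
     finite (pverts X) \<and> card (pverts X) = k + m \<and>
     (\<exists>T \<subseteq> pverts X. card T = k \<and> parcs X = {(u, v). u \<in> T \<and> v \<in> T \<and> u \<noteq> v})"
  (is "graph_iso X ?Y \<longleftrightarrow> ?R")
proof -
  define E where "E = {(i, j). i \<in> {..<k} \<and> j \<in> {..<k} \<and> i \<noteq> j}"
  have Yv: "pverts ?Y = {..<k} <+> {..<m}" and Ya: "parcs ?Y = map_prod Inl Inl ` E"
    by (auto simp: disjoint_union_def complete_graph_def isolated_vertices_def E_def)
  show ?thesis
  proof
    assume "graph_iso X ?Y"
    then obtain f where sub: "parcs X \<subseteq> pverts X \<times> pverts X" and f: "inj_on f (pverts X)"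
        and V: "{..<k} <+> {..<m} = f ` pverts X"
        and A: "map_prod Inl Inl ` E = map_prod f f ` parcs X"
      unfolding graph_iso_iff Yv Ya by blast
    have fin: "finite (pverts X)"
      using finite_imageD[OF _ f] V by (metis finite_Plus finite_lessThan)
    have card: "card (pverts X) = k + m"
      using card_image[OF f] card_Plus[of "{..<k}" "{..<m}"] by (simp add: V[symmetric])
    define T where "T = {v \<in> pverts X. f v \<in> Inl ` {..<k}}"
    have "f ` T = f ` pverts X \<inter> Inl ` {..<k}"
      by (auto simp: T_def)
    then have "f ` T = Inl ` {..<k}"
      unfolding V[symmetric] by auto
    moreover have "inj_on f T" using f by (rule inj_on_subset) (auto simp: T_def)
    ultimately have "card T = k"
      by (metis card_image card_lessThan inj_Inl inj_on_subset subset_UNIV)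
    moreover have "(u, v) \<in> parcs X \<longleftrightarrow> u \<in> T \<and> v \<in> T \<and> u \<noteq> v" for u v
    proof
      assume uv: "(u, v) \<in> parcs X"
      then have "(f u, f v) \<in> map_prod Inl Inl ` E" using A by force
      then show "u \<in> T \<and> v \<in> T \<and> u \<noteq> v"
        using uv sub by (auto simp: T_def E_def)
    next
      assume uv: "u \<in> T \<and> v \<in> T \<and> u \<noteq> v"
      then have "f u \<noteq> f v" using f by (auto simp: T_def dest: inj_onD)
      then have "(f u, f v) \<in> map_prod Inl Inl ` E"
        using uv by (force simp: T_def E_def)
      then obtain u' v' where "(u', v') \<in> parcs X" "f u = f u'" "f v = f v'"
        unfolding A by auto
      moreover from this have "u = u'" "v = v'"
        using uv sub f by (auto simp: T_def dest: inj_onD)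
      ultimately show "(u, v) \<in> parcs X" by simp
    qed
    ultimately show ?R using fin card by (intro conjI exI[of _ T]) (auto simp: T_def)
  next
    assume ?R
    then obtain T where fin: "finite (pverts X)" and card: "card (pverts X) = k + m"
      and T: "T \<subseteq> pverts X" "card T = k"
      and A: "parcs X = {(u, v). u \<in> T \<and> v \<in> T \<and> u \<noteq> v}" by blast
    have finT: "finite T" using T fin finite_subset by blast
    then obtain g where g: "bij_betw g T {..<k}"
      using ex_bij_betw_finite_nat[of T] T by (auto simp: atLeast0LessThan)
    have "card (pverts X - T) = m" using card T finT by (simp add: card_Diff_subset)
    then obtain g' where g': "bij_betw g' (pverts X - T) {..<m}"
      using ex_bij_betw_finite_nat[of "pverts X - T"] fin by (auto simp: atLeast0LessThan)
    define f where "f v = (if v \<in> T then Inl (g v) else Inr (g' v))" for v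
    have "inj_on f (pverts X)"
      using g g' by (auto simp: inj_on_def f_def bij_betw_def)
    moreover have "{..<k} <+> {..<m} = f ` pverts X"
    proof -
      have "pverts X = T \<union> (pverts X - T)" using T by blast
      then have "f ` pverts X = f ` T \<union> f ` (pverts X - T)" by (metis image_Un)
      also have "f ` T = Inl ` g ` T" by (auto simp: f_def)
      also have "f ` (pverts X - T) = Inr ` g' ` (pverts X - T)" by (force simp: f_def)
      finally show ?thesis using g g' by (simp add: bij_betw_def Plus_def)
    qed
    moreover have "map_prod Inl Inl ` E = map_prod f f ` parcs X"
    proof -
      have "map_prod g g ` parcs X = E"
      proof -
        have inj: "g u = g v \<longleftrightarrow> u = v" if "u \<in> T" "v \<in> T" for u v
          using g that by (auto simp: bij_betw_def inj_on_def)
        have gT: "{..<k} = g ` T" using g by (simp add: bij_betw_def)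
        show ?thesis
        proof (intro equalityI subrelI)
          fix i j assume "(i, j) \<in> E"
          then obtain u v where "u \<in> T" "v \<in> T" "i = g u" "j = g v" "u \<noteq> v"
            unfolding E_def gT by blast
          then show "(i, j) \<in> map_prod g g ` parcs X"
            unfolding A by (intro image_eqI[of _ _ "(u, v)"]) auto
        qed (auto simp: A E_def gT inj)
      qed
      then have "map_prod Inl Inl ` E = (\<lambda>e. map_prod Inl Inl (map_prod g g e)) ` parcs X"
        by (metis image_image)
      also have "\<dots> = map_prod f f ` parcs X"
        by (rule image_cong) (auto simp: A f_def)
      finally show ?thesis .
    qed
    ultimately show "graph_iso X ?Y"
      using T unfolding graph_iso_iff Yv Ya A by blast
  qed
qed

section \<open>Cyclic subgroups\<close>

context group
begin

lemma generate_singleton: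
  "x \<in> carrier G \<Longrightarrow> generate G {x} = range (\<lambda>i::int. x [^] i)"
  using generate_pow by blast

lemma generate_singleton_mono:
  assumes "z \<in> carrier G" "x \<in> generate G {z}"
  shows "generate G {x} \<subseteq> generate G {z}"
  using assms by (intro generate_subgroup_incl generate_is_subgroup) auto

lemma generate_involution:
  assumes x: "x \<in> carrier G" and "x \<otimes> x = \<one>"
  shows "generate G {x} = {\<one>, x}"
proof
  have "inv x = x" using assms inv_unique' by metis
  then have "subgroup {\<one>, x} G"
    using assms by (intro subgroupI) auto
  then show "generate G {x} \<subseteq> {\<one>, x}" by (intro generate_subgroup_incl) auto
qed (auto intro: generate.one generate.incl)

text \<open>
  From right to left this is the fact that subgroups of cyclic groups are cyclic: by Bezout's
  identity, \<open>z [^] i\<close> and \<open>z [^] j\<close> together generate the same subgroup as \<open>z [^] gcd i j\<close>.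
\<close>

lemma cyclic_group_pair_iff:
  assumes "x \<in> carrier G" "y \<in> carrier G"
  shows "cyclic_group (subgroup_generated G {x, y}) \<longleftrightarrow>
    (\<exists>z \<in> carrier G. x \<in> generate G {z} \<and> y \<in> generate G {z})"
proof
  assume "cyclic_group (subgroup_generated G {x, y})"
  then obtain z where z: "z \<in> carrier (subgroup_generated G {x, y})"
    and eq: "subgroup_generated (subgroup_generated G {x, y}) {z} = subgroup_generated G {x, y}"
    unfolding cyclic_group_def by blast
  interpret H: group "subgroup_generated G {x, y}" by (rule group_subgroup_generated)
  have zG: "z \<in> carrier G" using z carrier_subgroup_generated_subset by blast
  have "carrier (subgroup_generated G {x, y}) = range (\<lambda>i::int. z [^]\<^bsub>subgroup_generated G {x, y}\<^esub> i)"
    using H.carrier_subgroup_generated_by_singleton[OF z] eq by simp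
  also have "\<dots> = range (\<lambda>i::int. z [^] i)"
    using z by (intro image_cong refl int_pow_subgroup_generated)
  finally have "carrier (subgroup_generated G {x, y}) = generate G {z}"
    by (simp add: generate_singleton zG)
  moreover have "{x, y} \<subseteq> carrier (subgroup_generated G {x, y})"
    using assms by (intro subgroup_generated_subset_carrier_subset) auto
  ultimately show "\<exists>z \<in> carrier G. x \<in> generate G {z} \<and> y \<in> generate G {z}" using zG by auto
next
  assume "\<exists>z \<in> carrier G. x \<in> generate G {z} \<and> y \<in> generate G {z}"
  then obtain z and i j :: int where z: "z \<in> carrier G" and x: "x = z [^] i" and y: "y = z [^] j"
    by (auto simp: generate_singleton)
  define w where "w = z [^] gcd i j"
  have w: "w \<in> carrier G" using z by (simp add: w_def)
  obtain a b where ab: "a * i + b * j = gcd i j" using bezout_int by blast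
  have "w = x [^] a \<otimes> y [^] b"
    using z by (simp add: w_def x y int_pow_pow int_pow_mult mult.commute flip: ab)
  moreover have sub: "subgroup (generate G {x, y}) G"
    using assms by (intro generate_is_subgroup) auto
  ultimately have "w \<in> generate G {x, y}"
    using subgroup.m_closed[OF sub] subgroup_int_pow_closed[OF sub] generate.incl[of _ "{x, y}" G]
    by simp
  then have "generate G {w} \<subseteq> generate G {x, y}"
    using sub by (intro generate_subgroup_incl) auto
  moreover have "x \<in> generate G {w}" "y \<in> generate G {w}"
  proof -
    have "x = w [^] (i div gcd i j)" "y = w [^] (j div gcd i j)"
      using z by (simp_all add: w_def x y int_pow_pow)
    then show "x \<in> generate G {w}" "y \<in> generate G {w}"
      using w by (auto simp: generate_singleton)
  qed
  then have "generate G {x, y} \<subseteq> generate G {w}"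
    using w by (intro generate_subgroup_incl generate_is_subgroup) auto
  ultimately have "subgroup_generated G {x, y} = subgroup_generated G {w}"
    using assms w by (simp add: subgroup_generated_def)
  then show "cyclic_group (subgroup_generated G {x, y})"
    by (simp add: cyclic_group_generated)
qed

lemma one_in_cyclicizer: "\<one> \<in> cyclicizer G"
  unfolding cyclicizer_def
  by (auto simp: cyclic_group_pair_iff intro: generate.one generate.incl)

text \<open>
  A common cyclic overgroup \<open>\<langle>z\<rangle>\<close> of two distinct nontrivial elements has at least three elements,
  so \<open>z \<otimes> z \<noteq> \<one>\<close> and \<open>z\<close> must be in \<open>\<langle>x\<rangle>\<close>.
\<close>

lemma cyclic_pair_iff_if_involutions_outside:
  assumes x: "x \<in> carrier G" and inv: "\<And>y. y \<in> carrier G - generate G {x} \<Longrightarrow> y \<otimes> y = \<one>"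
    and uv: "u \<in> carrier G - {\<one>}" "v \<in> carrier G - {\<one>}" "u \<noteq> v"
  shows "cyclic_group (subgroup_generated G {u, v}) \<longleftrightarrow> u \<in> generate G {x} \<and> v \<in> generate G {x}"
proof
  assume "cyclic_group (subgroup_generated G {u, v})"
  then obtain z where z: "z \<in> carrier G" "u \<in> generate G {z}" "v \<in> generate G {z}"
    using uv by (auto simp: cyclic_group_pair_iff)
  have "z \<in> generate G {x}"
  proof (rule ccontr)
    assume "z \<notin> generate G {x}"
    then have "generate G {z} = {\<one>, z}" using z inv by (intro generate_involution) auto
    then show False using z uv by auto
  qed
  then show "u \<in> generate G {x} \<and> v \<in> generate G {x}"
    using generate_singleton_mono[OF x] z by blast
qed (use x uv in \<open>auto simp: cyclic_group_pair_iff\<close>)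

text \<open>
  Any \<open>z\<close> with \<open>z \<otimes> z \<noteq> \<one>\<close> lies in \<open>T\<close> along with all nontrivial elements of \<open>\<langle>z\<rangle>\<close>, as \<open>z\<close> is joined to its
  inverse and to its other powers.  It remains to find such a \<open>z\<close> whose subgroup exhausts \<open>T\<close>.
  An edge of \<open>T\<close> gives a \<open>w\<close> with two of the three elements in \<open>\<langle>w\<rangle>\<close>; if the third is missing,
  then \<open>w\<close> itself is in \<open>T\<close>, and the edge from \<open>w\<close> to the third element enlarges \<open>\<langle>w\<rangle>\<close>.
\<close>

lemma cyclic_subgroup_of_unique_triangle:
  assumes T: "card T = 3" "T \<subseteq> carrier G - {\<one>}"
    and iff: "\<And>u v. \<lbrakk>u \<in> carrier G - {\<one>}; v \<in> carrier G - {\<one>}; u \<noteq> v\<rbrakk> \<Longrightarrow>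
       cyclic_group (subgroup_generated G {u, v}) \<longleftrightarrow> u \<in> T \<and> v \<in> T"
  shows "\<exists>x \<in> carrier G. generate G {x} = insert \<one> T \<and>
     (\<forall>y \<in> carrier G - generate G {x}. y \<otimes> y = \<one>)"
proof -
  have large: "generate G {z} \<subseteq> insert \<one> T" if z: "z \<in> carrier G" "z \<otimes> z \<noteq> \<one>" for z
  proof
    have z1: "z \<noteq> \<one>" using z by auto
    have adj: "z \<in> T \<and> w \<in> T" if w: "w \<in> generate G {z}" "w \<noteq> \<one>" "w \<noteq> z" for w
    proof -
      have wG: "w \<in> carrier G" using w z generate_incl[of "{z}"] by auto
      have "cyclic_group (subgroup_generated G {z, w})"
        using z w wG by (auto simp: cyclic_group_pair_iff intro!: bexI[of _ z] generate.incl)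
      then show ?thesis using iff[of z w] w wG z z1 by auto
    qed
    have "inv z \<noteq> z" using z by (metis r_inv)
    then have "z \<in> T" using adj[of "inv z"] z z1 by (auto intro: generate.inv)
    then show "w \<in> insert \<one> T" if "w \<in> generate G {z}" for w
      using adj that by blast
  qed
  have gen: "\<exists>w \<in> carrier G. w \<otimes> w \<noteq> \<one> \<and> p \<in> generate G {w} \<and> q \<in> generate G {w}"
    if "p \<in> T" "q \<in> T" "p \<noteq> q" for p q
  proof -
    have pq: "p \<in> carrier G - {\<one>}" "q \<in> carrier G - {\<one>}" "p \<noteq> q" using that T by auto
    then have "cyclic_group (subgroup_generated G {p, q})" using iff that by blast
    then obtain w where w: "w \<in> carrier G" "p \<in> generate G {w}" "q \<in> generate G {w}"
      using pq by (auto simp: cyclic_group_pair_iff)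
    moreover have "w \<otimes> w \<noteq> \<one>"
      using generate_involution[of w] w that T by auto
    ultimately show ?thesis by blast
  qed
  obtain u v t where Teq: "T = {u, v, t}" and ne: "u \<noteq> v" "u \<noteq> t" "v \<noteq> t"
    using T(1) by (auto simp: card_3_iff)
  obtain w where w: "w \<in> carrier G" "w \<otimes> w \<noteq> \<one>" "u \<in> generate G {w}" "v \<in> generate G {w}"
    using gen[of u v] Teq ne by auto
  have "\<exists>x \<in> carrier G. x \<otimes> x \<noteq> \<one> \<and> T \<subseteq> generate G {x}"
  proof (cases "t \<in> generate G {w}")
    case True
    then show ?thesis using w Teq by auto
  next
    case False
    have "w \<in> generate G {w}" by (simp add: generate.incl)
    moreover have "w \<noteq> \<one>" using w(1,2) by auto
    ultimately have "w \<in> T" "w \<noteq> t" using large[OF w(1,2)] False by auto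
    then obtain x where x: "x \<in> carrier G" "x \<otimes> x \<noteq> \<one>" "w \<in> generate G {x}" "t \<in> generate G {x}"
      using gen[of w t] Teq by auto
    have "generate G {w} \<subseteq> generate G {x}" using generate_singleton_mono x by blast
    then show ?thesis using x w Teq by auto
  qed
  then obtain x where x: "x \<in> carrier G" "x \<otimes> x \<noteq> \<one>" "T \<subseteq> generate G {x}" by blast
  then have eq: "generate G {x} = insert \<one> T" using large[of x] generate.one[of G "{x}"] by auto
  moreover have "y \<otimes> y = \<one>" if "y \<in> carrier G - generate G {x}" for y
    using that large[of y] eq generate.incl[of y "{y}" G] by auto
  ultimately show ?thesis using x by blast
qed

end

section \<open>Dihedral groups\<close>

text \<open>
  For \<open>c\<close> outside \<open>\<langle>x\<rangle>\<close> every \<open>c \<otimes> x [^] i\<close> is again outside, hence its own inverse; this says that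
  \<open>c\<close> inverts \<open>x\<close> by conjugation (\<open>flip\<close> below).  Fixing one such element \<open>y\<close> as the reflection, any other
  \<open>z\<close> inverts \<open>x\<close> too, so \<open>z \<otimes> y\<close> centralises \<open>x\<close>.  Were it outside \<open>\<langle>x\<rangle>\<close>, it would also invert \<open>x\<close>,
  forcing \<open>x = inv x\<close>; thus \<open>\<langle>x\<rangle>\<close> has index 2 (\<open>cover\<close>).  An \<open>x\<close> of infinite order has \<open>ord x = 0\<close>, in
  agreement with \<open>dihedral_group 0\<close> being the infinite dihedral group.
\<close>

lemma (in group) iso_dihedral_groupI:
  assumes x: "x \<in> carrier G" "x \<otimes> x \<noteq> \<one>"
    and proper: "generate G {x} \<noteq> carrier G"
    and invol: "\<And>y. y \<in> carrier G - generate G {x} \<Longrightarrow> y \<otimes> y = \<one>"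
  shows "G \<cong> dihedral_group (ord x)"
proof -
  have sub: "subgroup (generate G {x}) G" using x by (intro generate_is_subgroup) auto
  have pow: "x [^] i \<in> generate G {x}" for i :: int using x by (auto simp: generate_singleton)
  obtain y where y: "y \<in> carrier G" "y \<notin> generate G {x}"
    using proper subgroup.subset[OF sub] by blast
  have yy: "y \<otimes> y = \<one>" using y invol by blast
  have notin: "c \<otimes> x [^] i \<notin> generate G {x}" "x [^] i \<otimes> c \<notin> generate G {x}"
    if "c \<in> carrier G" "c \<notin> generate G {x}" for c and i :: int
  proof -
    have "c = (c \<otimes> x [^] i) \<otimes> x [^] (- i)"
      using that x by (simp add: int_pow_neg m_assoc)
    then show "c \<otimes> x [^] i \<notin> generate G {x}"
      using that pow subgroup.m_closed[OF sub] by metis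
    have "c = x [^] (- i) \<otimes> (x [^] i \<otimes> c)"
      using that x by (simp add: int_pow_neg flip: m_assoc)
    then show "x [^] i \<otimes> c \<notin> generate G {x}"
      using that pow subgroup.m_closed[OF sub] by metis
  qed
  have flip: "c \<otimes> x [^] i = x [^] (- i) \<otimes> c"
    if c: "c \<in> carrier G" "c \<notin> generate G {x}" for c and i :: int
  proof -
    have "(c \<otimes> x [^] i) \<otimes> (c \<otimes> x [^] i) = \<one>" using c notin(1) x by (intro invol) auto
    then have "c \<otimes> x [^] i = inv (c \<otimes> x [^] i)" using c x by (metis inv_unique' m_closed int_pow_closed)
    also have "\<dots> = x [^] (- i) \<otimes> inv c" using c x by (simp add: inv_mult_group int_pow_neg)
    also have "inv c = c" using c invol by (metis DiffI inv_unique')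
    finally show ?thesis .
  qed
  have cover: "z \<otimes> y \<in> generate G {x}" if z: "z \<in> carrier G" "z \<notin> generate G {x}" for z
  proof (rule ccontr)
    assume zy: "z \<otimes> y \<notin> generate G {x}"
    have "x \<otimes> (z \<otimes> y) = z \<otimes> (x [^] (- 1 :: int) \<otimes> y)"
      using flip[OF z, of "-1"] z y x by (simp add: m_assoc[symmetric])
    also have "\<dots> = (z \<otimes> y) \<otimes> x"
      using flip[OF y, of 1] z y x by (simp add: m_assoc)
    also have "\<dots> = inv x \<otimes> (z \<otimes> y)"
      using flip[OF _ zy, of 1] z y x by (simp add: int_pow_neg)
    finally have "x = inv x" using x y z by (metis inv_closed m_closed right_cancel)
    then show False using x by (metis r_inv)
  qed
  have poweq: "x [^] a = x [^] b \<longleftrightarrow> a mod int (ord x) = b mod int (ord x)" for a b :: int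
    using int_pow_eq[of x a b] x by (metis mod_eq_dvd_iff dvd_diff_commute)
  have carrier: "carrier (dihedral_group (ord x)) =
      {(a, e). a mod int (ord x) = a}"
    by (auto simp: dihedral_group_def carrier_integer_mod_group split: if_splits)
       (metis gr0I of_nat_0_less_iff pos_mod_sign, metis gr0I of_nat_0_less_iff pos_mod_bound)
  define h where "h = (\<lambda>(a::int, e). x [^] a \<otimes> (if e then y else \<one>))"
  have closed: "h p \<in> carrier G" for p using x y by (auto simp: h_def split: prod.splits)
  have "h ((a, e) \<otimes>\<^bsub>dihedral_group (ord x)\<^esub> (b, f)) = h (a, e) \<otimes> h (b, f)" for a b e f
  proof (cases e)
    case False
    have "x [^] ((a + b) mod int (ord x)) = x [^] a \<otimes> x [^] b"
      using x poweq[of "(a + b) mod int (ord x)" "a + b"] by (simp add: int_pow_mult)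
    then show ?thesis
      using False x y by (simp add: h_def dihedral_group_def m_assoc)
  next
    case True
    have 1: "x [^] ((a - b) mod int (ord x)) = x [^] a \<otimes> x [^] (- b)"
      using x poweq[of "(a - b) mod int (ord x)" "a - b"] by (simp flip: int_pow_mult)
    have "x [^] a \<otimes> y \<otimes> (x [^] b \<otimes> c) = x [^] a \<otimes> x [^] (- b) \<otimes> (y \<otimes> c)"
      if "c \<in> carrier G" for c
      using flip[OF y, of b] that x y by (metis int_pow_closed m_assoc m_closed)
    then show ?thesis
      using True x y yy 1 by (simp add: h_def dihedral_group_def)
  qed
  then have "h \<in> hom (dihedral_group (ord x)) G"
    using closed by (auto simp: hom_def)
  moreover have "inj_on h (carrier (dihedral_group (ord x)))"
  proof (rule inj_onI, clarify)
    fix a e b f assume ab: "(a, e) \<in> carrier (dihedral_group (ord x))"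
      "(b, f) \<in> carrier (dihedral_group (ord x))" and eq: "h (a, e) = h (b, f)"
    have "e = f"
      using eq pow notin(2)[OF y] x by (auto simp: h_def split: if_splits) (metis, metis)
    moreover from this have "x [^] a = x [^] b"
      using eq x y by (auto simp: h_def split: if_splits)
    ultimately show "a = b \<and> e = f" using ab poweq by (simp add: carrier)
  qed
  moreover have "h ` carrier (dihedral_group (ord x)) = carrier G"
  proof
    show "carrier G \<subseteq> h ` carrier (dihedral_group (ord x))"
    proof
      fix z assume z: "z \<in> carrier G"
      have *: "x [^] i \<otimes> (if e then y else \<one>) \<in> h ` carrier (dihedral_group (ord x))" for i :: int and e
        using poweq[of i "i mod int (ord x)"]
        by (intro image_eqI[of _ _ "(i mod int (ord x), e)"]) (auto simp: h_def carrier)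
      show "z \<in> h ` carrier (dihedral_group (ord x))"
      proof (cases "z \<in> generate G {x}")
        case True
        then obtain i :: int where "z = x [^] i" using x by (auto simp: generate_singleton)
        then show ?thesis using *[of i False] x by simp
      next
        case False
        then obtain i :: int where i: "z \<otimes> y = x [^] i"
          using cover z x by (auto simp: generate_singleton)
        have "z = (z \<otimes> y) \<otimes> y" using z y yy by (simp add: m_assoc)
        then show ?thesis using *[of i True] i by simp
      qed
    qed
  qed (use closed in auto)
  ultimately have "dihedral_group (ord x) \<cong> G" by (auto simp: is_iso_def iso_def bij_betw_def)
  then show ?thesis using group.iso_sym[OF group_dihedral_group] by blast
qed

text \<open>
  The image \<open>x\<close> of the rotation \<open>r\<close> works: everything outside \<open>\<langle>x\<rangle>\<close> is the image of a reflection.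
\<close>

lemma (in group) iso_dihedral_groupD:
  assumes "G \<cong> dihedral_group m"
  shows "\<exists>x \<in> carrier G. ord x = m \<and> (\<forall>y \<in> carrier G - generate G {x}. y \<otimes> y = \<one>)"
proof -
  let ?D = "dihedral_group m"
  interpret D: group ?D by (rule group_dihedral_group)
  obtain h where h: "h \<in> iso ?D G" using assms iso_sym by (auto simp: is_iso_def)
  interpret h: group_hom ?D G h
    using h by unfold_locales (auto simp: iso_def)
  have inj: "inj_on h (carrier ?D)" and surj: "h ` carrier ?D = carrier G"
    using h by (auto simp: iso_def bij_betw_def)
  have carrier: "(i mod int m, e) \<in> carrier ?D" for i e
    by (auto simp: dihedral_group_def carrier_integer_mod_group)
  \<comment> \<open>The residue of 1 is 0 if \<open>m = 1\<close>, so the plain pair \<open>(1, False)\<close> would not be in the carrier.\<close>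
  define r where "r = (1 mod int m, False)"
  have r: "r \<in> carrier ?D" unfolding r_def by (rule carrier)
  have rpow: "r [^]\<^bsub>?D\<^esub> k = (int k mod int m, False)" for k :: nat
    by (induction k) (auto simp: r_def dihedral_group_def mod_simps nat_pow_def add.commute)
  have one: "\<one>\<^bsub>?D\<^esub> = (0, False)" by (simp add: dihedral_group_def)
  have rpow_int: "r [^]\<^bsub>?D\<^esub> i = (i mod int m, False)" for i :: int
  proof (cases i rule: int_cases2)
    case (nonneg k)
    then show ?thesis by (simp add: int_pow_int rpow)
  next
    case (nonpos k)
    have "inv\<^bsub>?D\<^esub> (int k mod int m, False) = (- int k mod int m, False)"
      using carrier[of "int k" False] carrier[of "- int k" False]
      by (intro D.inv_equality) (auto simp: dihedral_group_def mod_simps)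
    then show ?thesis using nonpos r by (simp add: D.int_pow_neg_int rpow)
  qed
  have "h r [^] k = \<one> \<longleftrightarrow> m dvd k" for k :: nat
  proof -
    have "h r [^] k = \<one> \<longleftrightarrow> h (r [^]\<^bsub>?D\<^esub> k) = h \<one>\<^bsub>?D\<^esub>" using r by (simp add: h.hom_nat_pow)
    also have "\<dots> \<longleftrightarrow> r [^]\<^bsub>?D\<^esub> k = \<one>\<^bsub>?D\<^esub>"
      using inj r by (intro inj_on_eq_iff) auto
    also have "\<dots> \<longleftrightarrow> m dvd k" by (auto simp: rpow one zmod_int[symmetric])
    finally show ?thesis .
  qed
  then have "ord (h r) = m" using ord_unique[of "h r" m] r by auto
  moreover have "z \<otimes> z = \<one>" if z: "z \<in> carrier G - generate G {h r}" for z
  proof -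
    obtain a e where ae: "(a, e) \<in> carrier ?D" "z = h (a, e)" using z unfolding surj[symmetric] by auto
    have e
    proof (rule ccontr)
      assume "\<not> e"
      moreover have "a mod int m = a"
        using ae(1) by (auto simp: dihedral_group_def carrier_integer_mod_group split: if_splits)
      ultimately have "(a, e) = r [^]\<^bsub>?D\<^esub> a" by (simp add: rpow_int)
      then have "z = h r [^] a" using ae r by (simp add: h.hom_int_pow)
      then show False using z r by (auto simp: generate_singleton)
    qed
    then have "(a, e) \<otimes>\<^bsub>?D\<^esub> (a, e) = \<one>\<^bsub>?D\<^esub>" by (simp add: dihedral_group_def)
    then show ?thesis using ae h.hom_mult[of "(a, e)" "(a, e)"] by simp
  qed
  ultimately show ?thesis using r by auto
qed

section \<open>The classification\<close>

context group
begin

lemma triangle_plus_isolated_iff: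
  assumes fin: "finite (carrier G)" and order: "order G = n" and card_cyc: "card (cyclicizer G) = 1"
  shows "graph_iso (graph_complement (non_cyclic_graph G))
           (disjoint_union (complete_graph 3) (isolated_vertices (n - 4))) \<longleftrightarrow>
    (\<exists>x. x \<in> carrier G \<and> ord x = 4 \<and> (\<forall>y \<in> carrier G - generate G {x}. y \<otimes> y = \<one>))"
    (is "_ \<longleftrightarrow> (\<exists>x. ?W x)")
proof -
  have cyc: "cyclicizer G = {\<one>}"
    using card_cyc one_in_cyclicizer by (metis card_1_singletonE singletonD)
  define V where "V = carrier G - {\<one>}"
  define X where "X = graph_complement (non_cyclic_graph G)"
  have Xv: "pverts X = V"
    by (simp add: X_def V_def graph_complement_def non_cyclic_graph_def cyc)
  have Xa: "parcs X = {(u, v). u \<in> V \<and> v \<in> V \<and> u \<noteq> v \<and> cyclic_group (subgroup_generated G {u, v})}"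
    by (auto simp: X_def V_def graph_complement_def non_cyclic_graph_def cyc)
  have card_V: "card V = n - 1" and finV: "finite V"
    using fin order by (simp_all add: V_def order_def)
  have gen1: "card (generate G {x}) = Suc (card (generate G {x} - {\<one>}))" if "x \<in> carrier G" for x
    using that fin generate_incl[of "{x}"]
    by (intro card.remove) (auto intro: generate.one finite_subset)
  have "graph_iso X (disjoint_union (complete_graph 3) (isolated_vertices (n - 4))) \<longleftrightarrow> (\<exists>x. ?W x)"
  proof
    assume "graph_iso X (disjoint_union (complete_graph 3) (isolated_vertices (n - 4)))"
    then obtain T where T: "T \<subseteq> V" "card T = 3"
      and A: "parcs X = {(u, v). u \<in> T \<and> v \<in> T \<and> u \<noteq> v}"
      unfolding graph_iso_complete_plus_isolated_iff Xv by blast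
    have "cyclic_group (subgroup_generated G {u, v}) \<longleftrightarrow> u \<in> T \<and> v \<in> T"
      if "u \<in> carrier G - {\<one>}" "v \<in> carrier G - {\<one>}" "u \<noteq> v" for u v
    proof -
      have "(u, v) \<in> parcs X \<longleftrightarrow> u \<in> T \<and> v \<in> T" using that A by simp
      then show ?thesis using that by (simp add: Xa V_def)
    qed
    then obtain x where x: "x \<in> carrier G" "generate G {x} = insert \<one> T"
        "\<forall>y \<in> carrier G - generate G {x}. y \<otimes> y = \<one>"
      using cyclic_subgroup_of_unique_triangle[of T] T by (auto simp: V_def)
    have "card (insert \<one> T) = 4" using T by (subst card_insert_disjoint) (auto simp: V_def intro: card_ge_0_finite)
    then have "ord x = 4" using x generate_pow_card[of x] by simp
    then show "\<exists>x. ?W x" using x by blast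
  next
    assume "\<exists>x. ?W x"
    then obtain x where x: "?W x" by blast
    define T where "T = generate G {x} - {\<one>}"
    have TV: "T \<subseteq> V" using x generate_incl[of "{x}"] by (auto simp: T_def V_def)
    have T3: "card T = 3" using gen1[of x] x generate_pow_card[of x] by (simp add: T_def)
    \<comment> \<open>Because of the triangle \<open>n \<ge> 4\<close>, so the subtraction \<open>n - 4\<close> is not truncated.\<close>
    have "n - 1 \<ge> 3" using card_mono[OF finV TV] T3 card_V by simp
    then have "card V = 3 + (n - 4)" using card_V by simp
    moreover have "parcs X = {(u, v). u \<in> T \<and> v \<in> T \<and> u \<noteq> v}"
    proof -
      have "cyclic_group (subgroup_generated G {u, v}) \<longleftrightarrow> u \<in> T \<and> v \<in> T"
        if "u \<in> V" "v \<in> V" "u \<noteq> v" for u v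
        using cyclic_pair_iff_if_involutions_outside[of x u v] x that by (auto simp: T_def V_def)
      then show ?thesis using TV by (auto simp: Xa)
    qed
    ultimately show "graph_iso X (disjoint_union (complete_graph 3) (isolated_vertices (n - 4)))"
      unfolding graph_iso_complete_plus_isolated_iff Xv using finV TV T3 by blast
  qed
  then show ?thesis unfolding X_def .
qed

text \<open>
  The cyclicizer rules out the cyclic group of order 4, which also has an element of order 4
  with nothing outside the subgroup it generates.
\<close>

lemma iso_dihedral_group_4_iff:
  assumes card_cyc: "card (cyclicizer G) = 1"
  shows "G \<cong> dihedral_group 4 \<longleftrightarrow>
    (\<exists>x. x \<in> carrier G \<and> ord x = 4 \<and> (\<forall>y \<in> carrier G - generate G {x}. y \<otimes> y = \<one>))"
    (is "_ \<longleftrightarrow> (\<exists>x. ?W x)")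
proof
  assume "G \<cong> dihedral_group 4"
  then show "\<exists>x. ?W x" using iso_dihedral_groupD[of 4] by auto
next
  have cyc: "cyclicizer G = {\<one>}"
    using card_cyc one_in_cyclicizer by (metis card_1_singletonE singletonD)
  assume "\<exists>x. ?W x"
  then obtain x where x: "?W x" by blast
  have x2: "x \<otimes> x \<noteq> \<one>" using x pow_eq_id[of x 2] by (auto simp: numeral_2_eq_2 dest: dvd_imp_le)
  have "generate G {x} \<noteq> carrier G"
  proof
    assume "generate G {x} = carrier G"
    then have "x \<in> cyclicizer G"
      using x by (auto simp: cyclicizer_def cyclic_group_pair_iff)
    then show False using x2 cyc by simp
  qed
  then show "G \<cong> dihedral_group 4" using iso_dihedral_groupI[of x] x x2 by auto
qed

end

theorem theorem3:
  fixes G :: "('a, 'b) monoid_scheme" and n :: nat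
  assumes "group G" and "finite (carrier G)" and "order G = n"
    and "\<not> locally_cyclic G" and "card (cyclicizer G) = 1"
  shows "graph_iso (graph_complement (non_cyclic_graph G))
           (disjoint_union (complete_graph 3) (isolated_vertices (n - 4)))
         \<longleftrightarrow> n = 8 \<and> G \<cong> dihedral_group 4"
proof -
  interpret group G by fact
  have "G \<cong> dihedral_group 4 \<longrightarrow> n = 8"
    using iso_same_card[of G "dihedral_group 4"] order_dihedral_group[of 4] assms(3)
    by (auto simp: order_def)
  then show ?thesis
    using triangle_plus_isolated_iff iso_dihedral_group_4_iff assms by blast
qed

end
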